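(* For every integer $n\ge1$, $spt_o^{-}(2n)\equiv 0\pmod 2$.
   Context: For a nonempty integer partition $\pi$, let $s(\pi)$ be its smallest part, and call $\pi$ admissible if no odd part of $\pi$ is greater than $2s(\pi)$. For $l\ge1$ let $\delta_l=(l-1,l-2,\dots,1)$, a partition of size $\binom{l}{2}$. $spt_o^{-}(m)$ is the total number of occurrences of $s(\pi)$ in $\pi$, summed over all pairs $(\pi,\delta_{s(\pi)})$ with $\pi$ admissible and $|\pi|+\binom{s(\pi)}{2}=m$; equivalently $\sum_{m\ge1}spt_o^{-}(m)q^m=\sum_{n\ge1}\frac{q^{n(n+1)/2}(q^{2n+1};q^2)_\infty}{(1-q^n)^2(q^{n+1};q)_\infty}$, where $(a;q)_\infty=\prod_{k\ge0}(1-aq^k)$. *)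

theory Defs
  imports "HOL-Library.Multiset" "HOL-Number_Theory.Cong"
begin

(* A partition is the multiset of its parts; its size is sum_mset. *)

definition is_partition :: "nat multiset \<Rightarrow> bool" where
  "is_partition p \<longleftrightarrow> (\<forall>k \<in># p. 0 < k)"

(* Only meaningful for nonempty p, since Min {} is unspecified. *)
definition smallest_part :: "nat multiset \<Rightarrow> nat" where
  "smallest_part p = Min (set_mset p)"

definition admissible :: "nat multiset \<Rightarrow> bool" where
  "admissible p \<longleftrightarrow> (\<forall>k \<in># p. odd k \<longrightarrow> k \<le> 2 * smallest_part p)"

definition staircase :: "nat \<Rightarrow> nat multiset" where
  "staircase l = mset [1..<l]"

definition spt_o_minus_pairs :: "nat \<Rightarrow> (nat multiset \<times> nat multiset) set" where
  "spt_o_minus_pairs m =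
     {(p, d). is_partition p \<and> p \<noteq> {#} \<and> admissible p \<and> d = staircase (smallest_part p)
              \<and> sum_mset p + sum_mset d = m}"

definition spt_o_minus :: "nat \<Rightarrow> nat" where
  "spt_o_minus m = (\<Sum>(p, d) \<in> spt_o_minus_pairs m. count p (smallest_part p))"

lemma sum_mset_staircase: "sum_mset (staircase l) = l choose 2"
proof (induction l)
  case 0
  then show ?case by (simp add: staircase_def)
next
  case (Suc l)
  then show ?case
    by (cases l) (simp_all add: staircase_def numeral_2_eq_2)
qed

lemma is_partition_size_le:
  assumes "is_partition p"
  shows "size p \<le> sum_mset p"
  using assms by (induction p) (auto simp: is_partition_def)

(* The sum in spt_o_minus_def is over a finite set, so it is not 0 by convention. *)
lemma finite_spt_o_minus_pairs: "finite (spt_o_minus_pairs m)"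
proof -
  let ?L = "{xs. set xs \<subseteq> {..m} \<and> length xs \<le> m}"
  have "spt_o_minus_pairs m \<subseteq> (\<lambda>xs. (mset xs, staircase (smallest_part (mset xs)))) ` ?L"
  proof
    fix x assume "x \<in> spt_o_minus_pairs m"
    then obtain p where p: "x = (p, staircase (smallest_part p))" "is_partition p" "sum_mset p \<le> m"
      by (auto simp: spt_o_minus_pairs_def)
    obtain xs where xs: "mset xs = p" using ex_mset by blast
    have "length xs \<le> m"
      using is_partition_size_le[OF p(2)] p(3) by (simp flip: xs)
    moreover have "set xs \<subseteq> {..m}"
    proof
      fix k assume "k \<in> set xs"
      then have "k \<le> sum_mset p"
        using member_le_sum_list[of k xs] by (simp flip: xs add: sum_mset_sum_list)
      then show "k \<in> {..m}" using p(3) by simp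
    qed
    ultimately show "x \<in> (\<lambda>xs. (mset xs, staircase (smallest_part (mset xs)))) ` ?L"
      using p(1) xs by blast
  qed
  moreover have "finite ?L" by (intro finite_lists_length_le) simp
  ultimately show ?thesis by (meson finite_imageI finite_subset)
qed

end

theory Submission
  imports Defs "HOL-Library.Z2" "HOL-Computational_Algebra.Formal_Power_Series"
begin

text \<open>
  Write \<open>(q)_n = (1 - q) \<dots> (1 - q^n)\<close>. Over the two-element field \<open>(1 - q^s)^2 = 1 - q^(2s)\<close>, so
  the generating function of \<open>spt_o_minus\<close>, with the even parts cut off at \<open>2K\<close>, becomes after
  multiplication by \<open>(q)_K^2\<close> the sum over \<open>s \<le> K\<close> of
  \<open>t_s = q^(s(s+1)/2) (q)_(s-1)^2 (q)_s / (q)_(2s)\<close>. The odd-index half of a finite Jacobi triple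
  product expands \<open>(q)_s (q)_(s-1) / (q)_(2s)\<close> as the sum over odd \<open>r \<le> s\<close> of
  \<open>q^(r(r-1)/2) (1 + q^r) / ((q)_(s-r) (q)_(s+r))\<close>. After this expansion the sum over \<open>s\<close> is
  evaluated by the q-Chu-Vandermonde formula, and \<open>t_1 + \<dots> + t_K\<close> agrees up to order \<open>K\<close> with the
  sum of \<open>q^(r^2)\<close> over odd \<open>r\<close>. No odd square is even and \<open>(q)_K^2\<close> is a power series in \<open>q^2\<close>,
  hence all even coefficients of the generating function vanish modulo 2.
\<close>

subsection \<open>q-binomial identities\<close>

lemma Suc_choose_two: "Suc k choose 2 = (k choose 2) + k"
  by (simp add: numeral_2_eq_2)

lemma add_choose_two: "(m + n) choose 2 = (m choose 2) + (n choose 2) + m * n"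
  by (induction n) (auto simp: Suc_choose_two algebra_simps)

text \<open>Gaussian binomial coefficients by the q-Pascal rule, which makes sense in every
  commutative ring. For \<open>k > n\<close> the truncated exponent \<open>n - k\<close> does no
  harm, since \<open>qbinomial q n k\<close> is 0.\<close>

fun qbinomial :: "'a::comm_ring_1 \<Rightarrow> nat \<Rightarrow> nat \<Rightarrow> 'a" where
  "qbinomial q n 0 = 1"
| "qbinomial q 0 (Suc k) = 0"
| "qbinomial q (Suc n) (Suc k) = qbinomial q n (Suc k) + q ^ (n - k) * qbinomial q n k"

definition qpoch :: "'a::comm_ring_1 \<Rightarrow> 'a \<Rightarrow> nat \<Rightarrow> 'a" where
  "qpoch a q n = (\<Prod>i<n. 1 - a * q ^ i)"

lemma qpoch_0 [simp]: "qpoch a q 0 = 1"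
  by (simp add: qpoch_def)

lemma qpoch_Suc: "qpoch a q (Suc n) = qpoch a q n * (1 - a * q ^ n)"
  by (simp add: qpoch_def)

lemma qpoch_Suc_shift: "qpoch a q (Suc n) = (1 - a) * qpoch (a * q) q n"
  by (simp add: qpoch_def prod.lessThan_Suc_shift algebra_simps del: prod.lessThan_Suc)

lemma qpoch_add: "qpoch a q (m + n) = qpoch a q m * qpoch (a * q ^ m) q n"
  by (induction n) (simp_all add: qpoch_Suc power_add mult.assoc)

lemma qbinomial_eq_0: "n < k \<Longrightarrow> qbinomial q n k = 0"
proof (induction n arbitrary: k)
  case 0
  then show ?case by (cases k) auto
next
  case (Suc n)
  then show ?case by (cases k) auto
qed

lemma qbinomial_self [simp]: "qbinomial q n n = 1"
  by (induction n) (auto simp: qbinomial_eq_0)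

text \<open>The factorial formula cleared of denominators. The induction runs over
  \<open>n + m\<close> because the q-Pascal rule lowers either \<open>n\<close> or \<open>m\<close>;
  its two parts combine by \<open>(1 - q^n) + q^n (1 - q^m) = 1 - q^(n+m)\<close>.\<close>

lemma qbinomial_qpoch:
  "qbinomial q (n + m) m * qpoch q q n * qpoch q q m = qpoch q q (n + m)"
proof (induction "n + m" arbitrary: n m)
  case 0
  then show ?case by simp
next
  case (Suc N)
  show ?case
  proof (cases n)
    case 0
    then show ?thesis by simp
  next
    case n: (Suc n')
    show ?thesis
    proof (cases m)
      case 0
      then show ?thesis by simp
    next
      case m: (Suc m')
      have N: "n' + m = N" "n + m' = N" using Suc n m by auto
      have h1: "qbinomial q N m * qpoch q q n' * qpoch q q m = qpoch q q N"
        using Suc(1)[of n' m] N by simp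
      have h2: "qbinomial q N m' * qpoch q q n * qpoch q q m' = qpoch q q N"
        using Suc(1)[of n m'] N by simp
      have "qbinomial q (n + m) m = qbinomial q N m + q ^ (Suc n') * qbinomial q N m'"
        using N n m by (metis Suc.hyps(2) add_diff_cancel_right' qbinomial.simps(3))
      then have "qbinomial q (n + m) m * qpoch q q n * qpoch q q m
          = (qbinomial q N m * qpoch q q n' * qpoch q q m) * (1 - q ^ Suc n')
          + (qbinomial q N m' * qpoch q q n * qpoch q q m') * (1 - q ^ Suc m') * q ^ Suc n'"
        by (simp add: n m qpoch_Suc algebra_simps)
      also have "\<dots> = qpoch q q N * (1 - q ^ Suc n' * q ^ Suc m')"
        unfolding h1 h2 by (simp add: algebra_simps)
      also have "\<dots> = qpoch q q (Suc N)"
      proof -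
        have "q ^ Suc n' * q ^ Suc m' = q * q ^ N" using N n by (auto simp: power_add)
        then show ?thesis by (simp add: qpoch_Suc)
      qed
      finally show ?thesis using Suc by simp
    qed
  qed
qed

text \<open>The classical sum with lower parameter \<open>a * b\<close>, multiplied by
  \<open>(ab)_M\<close> to avoid fractions. In the induction the q-Pascal rule leaves sums for
  \<open>a\<close> and for \<open>a * q\<close>, with coefficients \<open>1 - a * b * q ^ M\<close>
  and \<open>- b * q ^ M * (1 - a)\<close>, which add up to \<open>1 - b * q ^ M\<close>.\<close>

lemma q_Chu_Vandermonde:
  "(\<Sum>m\<le>M. (-1) ^ m * q ^ (m choose 2) * qbinomial q M m * qpoch a q m * b ^ m
       * qpoch (a * b * q ^ m) q (M - m)) = qpoch b q M"
proof (induction M arbitrary: a)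
  case 0
  then show ?case by (simp add: numeral_2_eq_2)
next
  case (Suc M)
  let ?t = "\<lambda>a M m. (-1) ^ m * q ^ (m choose 2) * qbinomial q M m * qpoch a q m * b ^ m
       * qpoch (a * b * q ^ m) q (M - m)"
  define u where "u m = (-1) ^ m * q ^ (m choose 2) * qbinomial q M m * qpoch a q m * b ^ m
       * qpoch (a * b * q ^ m) q (Suc M - m)" for m
  \<comment> \<open>The parameter moves to \<open>a * q\<close> because
    \<open>(a)_(m+1) = (1 - a) (aq)_m\<close>.\<close>
  define w where "w m = - b * q ^ M * (1 - a) * ?t (a * q) M m" for m
  have step: "?t a (Suc M) (Suc m) = u (Suc m) + w m" if "m \<le> M" for m
  proof -
    have e: "q ^ (Suc m choose 2) * q ^ (M - m) = q ^ (m choose 2) * q ^ M"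
      using that by (simp add: Suc_choose_two flip: power_add)
    have a: "a * q * b * q ^ m = a * b * q ^ Suc m" by (simp add: algebra_simps)
    have "?t a (Suc M) (Suc m) - u (Suc m)
      = - ((-1) ^ m * (q ^ (Suc m choose 2) * q ^ (M - m)) * qbinomial q M m
          * qpoch a q (Suc m) * b ^ Suc m * qpoch (a * b * q ^ Suc m) q (M - m))"
      by (simp add: u_def algebra_simps)
    also have "\<dots> = w m"
      unfolding e w_def a qpoch_Suc_shift by (simp add: algebra_simps)
    finally show ?thesis by (simp add: algebra_simps)
  qed
  have u: "u m = ?t a M m * (1 - a * b * q ^ M)" if "m \<le> M" for m
  proof -
    have q: "q ^ m * q ^ (M - m) = q ^ M"
      using that by (simp flip: power_add)
    have "qpoch (a * b * q ^ m) q (Suc M - m)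
        = qpoch (a * b * q ^ m) q (M - m) * (1 - a * b * (q ^ m * q ^ (M - m)))"
      using that by (simp add: Suc_diff_le qpoch_Suc mult_ac)
    then show ?thesis unfolding q by (simp add: u_def mult_ac)
  qed
  have "(\<Sum>m\<le>Suc M. ?t a (Suc M) m) = u 0 + (\<Sum>m\<le>M. ?t a (Suc M) (Suc m))"
    by (subst sum.atMost_Suc_shift) (simp add: u_def numeral_2_eq_2)
  also have "\<dots> = u 0 + (\<Sum>m\<le>M. u (Suc m)) + (\<Sum>m\<le>M. w m)"
    using step by (simp add: sum.distrib)
  \<comment> \<open>The extra top term \<open>u (Suc M)\<close> contains
    \<open>qbinomial q M (Suc M) = 0\<close>.\<close>
  also have "u 0 + (\<Sum>m\<le>M. u (Suc m)) = (\<Sum>m\<le>M. u m)"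
    by (simp flip: sum.atMost_Suc_shift) (simp add: u_def qbinomial_eq_0)
  also have "\<dots> = (1 - a * b * q ^ M) * qpoch b q M"
    using u Suc[of a] by (simp flip: sum_distrib_right)
  also have "(\<Sum>m\<le>M. w m) = - b * q ^ M * (1 - a) * qpoch b q M"
    unfolding w_def Suc[of "a * q", symmetric] by (simp add: sum_distrib_left)
  finally show ?case by (simp add: qpoch_Suc algebra_simps)
qed

section \<open>Parity halves of the q-binomial theorem\<close>

text \<open>The even and the odd half of the q-binomial expansion of
  \<open>\<Prod>i<n. y + q ^ i\<close>.\<close>
definition parity_half :: "'a::comm_ring_1 \<Rightarrow> 'a \<Rightarrow> bool \<Rightarrow> nat \<Rightarrow> 'a" where
  "parity_half q y b n =
     (\<Sum>k | k \<le> n \<and> odd k = b. q ^ (k choose 2) * y ^ (n - k) * qbinomial q n k)"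

lemma parity_half_0: "parity_half q y b 0 = (if b then 0 else 1)"
proof -
  have "{k. k \<le> 0 \<and> odd k = b} = (if b then {} else {0::nat})" by (auto intro: odd_pos)
  then show ?thesis by (simp add: parity_half_def numeral_2_eq_2)
qed

text \<open>Effect of one more factor \<open>y + q ^ n\<close>: choosing \<open>y\<close> keeps the
  parity of the number \<open>k\<close> of chosen powers of \<open>q\<close>, choosing
  \<open>q ^ n\<close> flips it.\<close>

lemma parity_half_Suc:
  "parity_half q y b (Suc n) = y * parity_half q y b n + q ^ n * parity_half q y (\<not> b) n"
proof -
  define g where "g n k = q ^ (k choose 2) * y ^ (n - k) * qbinomial q n k" for n k
  have ph: "parity_half q y b n = (\<Sum>k\<le>n. if odd k = b then g n k else 0)" for b n
    unfolding parity_half_def g_def by (rule sum.mono_neutral_cong_left) (auto intro: odd_pos)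
  have s: "g (Suc n) (Suc k) = (if k < n then y * g n (Suc k) else 0) + q ^ n * g n k" if "k \<le> n" for k
  proof -
    have y: "y ^ (n - k) = y * y ^ (n - Suc k)" if "k < n"
      using that by (simp add: Suc_diff_Suc flip: power_Suc)
    have e: "q ^ (Suc k choose 2) * q ^ (n - k) = q ^ n * q ^ (k choose 2)"
      using that by (simp add: Suc_choose_two add.commute flip: power_add)
    have "g (Suc n) (Suc k) = q ^ (Suc k choose 2) * y ^ (n - k) * qbinomial q n (Suc k)
       + (q ^ (Suc k choose 2) * q ^ (n - k)) * y ^ (n - k) * qbinomial q n k"
      by (simp add: g_def algebra_simps)
    also have "q ^ (Suc k choose 2) * y ^ (n - k) * qbinomial q n (Suc k)
        = (if k < n then y * g n (Suc k) else 0)"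
      using that by (cases "k < n") (auto simp: g_def qbinomial_eq_0 y)
    finally show ?thesis unfolding e by (simp add: g_def algebra_simps)
  qed
  have g0: "g (Suc n) 0 = y * g n 0" by (simp add: g_def)
  have "parity_half q y b (Suc n) = (if odd (0::nat) = b then y * g n 0 else 0)
     + (\<Sum>k\<le>n. if odd (Suc k) = b then g (Suc n) (Suc k) else 0)"
    unfolding ph by (subst sum.atMost_Suc_shift) (simp only: g0)
  also have "(\<Sum>k\<le>n. if odd (Suc k) = b then g (Suc n) (Suc k) else 0)
     = (\<Sum>k\<le>n. if odd (Suc k) = b then (if k < n then y * g n (Suc k) else 0) else 0)
     + (\<Sum>k\<le>n. if odd k = (\<not> b) then q ^ n * g n k else 0)"
    unfolding sum.distrib [symmetric] by (rule sum.cong) (auto simp: s)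
  also have "(\<Sum>k\<le>n. if odd (Suc k) = b then (if k < n then y * g n (Suc k) else 0) else 0)
     = (\<Sum>k<n. if odd (Suc k) = b then y * g n (Suc k) else 0)"
    by (rule sum.mono_neutral_cong_right) auto
  also have "(\<Sum>k\<le>n. if odd k = (\<not> b) then q ^ n * g n k else 0) = q ^ n * parity_half q y (\<not> b) n"
    unfolding ph sum_distrib_left by (rule sum.cong) auto
  also have "(if odd (0::nat) = b then y * g n 0 else 0)
     + ((\<Sum>k<n. if odd (Suc k) = b then y * g n (Suc k) else 0) + q ^ n * parity_half q y (\<not> b) n)
     = (\<Sum>k<Suc n. if odd k = b then y * g n k else 0) + q ^ n * parity_half q y (\<not> b) n"
    by (subst sum.lessThan_Suc_shift) (simp add: add.assoc)
  also have "(\<Sum>k<Suc n. if odd k = b then y * g n k else 0) = y * parity_half q y b n"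
    unfolding ph sum_distrib_left lessThan_Suc_atMost by (rule sum.cong) auto
  finally show ?thesis .
qed

lemma parity_half_sum:
  "parity_half q y b n + parity_half q y (\<not> b) n = (\<Prod>i<n. y + q ^ i)"
proof (induction n)
  case 0
  then show ?case by (simp add: parity_half_0)
next
  case (Suc n)
  have "(\<Prod>i<Suc n. y + q ^ i)
      = (parity_half q y b n + parity_half q y (\<not> b) n) * (y + q ^ n)"
    using Suc by simp
  then show ?case by (simp add: parity_half_Suc algebra_simps)
qed

text \<open>At step \<open>s\<close> both coefficients of the recursion \<open>parity_half_Suc\<close> equal \<open>q ^ s\<close>, so the two
  halves agree from then on.\<close>
lemma parity_half_balanced:
  "parity_half q (q ^ s) b (s + 1 + j)
     = q ^ s * (\<Prod>i<s. q ^ s + q ^ i) * (\<Prod>i<j. q ^ s + q ^ (s + 1 + i))"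
proof (induction j arbitrary: b)
  case 0
  have "parity_half q (q ^ s) b (Suc s)
      = q ^ s * (parity_half q (q ^ s) b s + parity_half q (q ^ s) (\<not> b) s)"
    by (simp only: parity_half_Suc algebra_simps)
  then show ?case by (simp add: parity_half_sum)
next
  case (Suc j)
  show ?case
    using Suc[of b] Suc[of "\<not> b"] by (simp add: parity_half_Suc algebra_simps)
qed

subsection \<open>An identity for odd squares in characteristic 2\<close>

lemma bit_fps_minus [simp]: "- (f :: bit fps) = f"
  by (rule fps_ext) simp

lemma bit_fps_diff [simp]: "(f :: bit fps) - g = f + g"
  by (metis bit_fps_minus diff_conv_add_uminus)

lemma bit_fps_add_self: "(f :: bit fps) + f = 0"
  by (metis bit_fps_diff diff_self)

lemma two_choose_two: "2 * (r choose 2) + r = r * r"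
  by (induction r) (auto simp: Suc_choose_two numeral_2_eq_2)

text \<open>This is \<open>(q)_n\<close> with \<open>fps_X\<close> for \<open>q\<close>. Its
  constant term is 1, so \<open>reuler\<close> is a true inverse.\<close>

definition euler :: "nat \<Rightarrow> bit fps" where
  "euler n = qpoch fps_X fps_X n"

abbreviation reuler :: "nat \<Rightarrow> bit fps" where
  "reuler n \<equiv> inverse (euler n)"

lemma euler_0 [simp]: "euler 0 = 1"
  by (simp add: euler_def)

lemma euler_Suc: "euler (Suc n) = euler n * (1 + fps_X ^ Suc n)"
  by (simp add: euler_def qpoch_Suc)

lemma euler_add: "euler (m + n) = euler m * qpoch (fps_X ^ Suc m) fps_X n"
  by (simp add: euler_def qpoch_add)

lemma euler_nth_0 [simp]: "fps_nth (euler n) 0 = 1"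
  by (induction n) (simp_all add: euler_Suc)

lemma euler_reuler [simp]: "euler n * reuler n = 1" "reuler n * euler n = 1"
  using inverse_mult_eq_1[of "euler n"] by (simp_all add: mult.commute)

lemma reuler_eqI:
  assumes "euler a = euler b * x"
  shows "reuler b = x * reuler a"
proof -
  have "x * reuler a = (reuler b * euler b) * x * reuler a"
    by (simp only: euler_reuler mult_1)
  also have "\<dots> = reuler b * (euler a * reuler a)"
    by (simp only: assms mult_ac)
  finally show ?thesis by simp
qed

lemma qbinomial_reuler:
  assumes "m \<le> n"
  shows "qbinomial fps_X n m * reuler n = reuler m * reuler (n - m)"
proof -
  have "qbinomial fps_X n m * euler (n - m) * euler m = euler n"
    using qbinomial_qpoch[of "fps_X :: bit fps" "n - m" m] assms by (simp add: euler_def)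
  then have "(qbinomial fps_X n m * reuler n) * (euler (n - m) * euler m) = 1"
    by (metis (no_types, lifting) euler_reuler(1) mult.assoc mult.commute)
  then have "(qbinomial fps_X n m * reuler n) * (euler (n - m) * euler m) * (reuler m * reuler (n - m))
     = reuler m * reuler (n - m)" by simp
  moreover have "(qbinomial fps_X n m * reuler n) * (euler (n - m) * euler m) * (reuler m * reuler (n - m))
     = (qbinomial fps_X n m * reuler n) * (euler (n - m) * reuler (n - m)) * (euler m * reuler m)"
    by (simp only: mult_ac)
  ultimately show ?thesis by simp
qed

section \<open>The odd half of the finite triple product\<close>

lemma prod_fps_X_power: "(\<Prod>i<s. fps_X ^ i) = (fps_X :: bit fps) ^ (s choose 2)"
  by (induction s) (simp_all add: Suc_choose_two power_add numeral_2_eq_2 [symmetric] binomial_eq_0)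

text \<open>The case \<open>j = s - 1\<close> of \<open>parity_half_balanced\<close>. Extracting
  powers of \<open>q\<close> from each factor, \<open>q^s + q^i = q^i (1 + q^(s-i))\<close> leaves
  \<open>(q)_s\<close>, and \<open>q^s + q^(s+1+i) = q^s (1 + q^(i+1))\<close> leaves
  \<open>(q)_(s-1)\<close>.\<close>

lemma parity_half_double:
  assumes "s \<ge> 1"
  shows "parity_half (fps_X :: bit fps) (fps_X ^ s) b (2 * s)
     = fps_X ^ ((s choose 2) + s * s) * euler s * euler (s - 1)"
proof -
  have e: "(\<Prod>i<s. 1 + fps_X ^ (s - i)) = euler s"
  proof -
    have "euler s = (\<Prod>i<s. 1 + fps_X ^ Suc (s - Suc i))"
      by (subst prod.nat_diff_reindex) (simp add: euler_def qpoch_def)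
    also have "\<dots> = (\<Prod>i<s. 1 + fps_X ^ (s - i))"
      by (intro prod.cong) (auto simp: Suc_diff_Suc simp del: power_Suc)
    finally show ?thesis by simp
  qed
  have "(\<Prod>i<s. fps_X ^ s + fps_X ^ i) = (\<Prod>i<s. fps_X ^ i * (1 + fps_X ^ (s - i)) :: bit fps)"
    by (intro prod.cong) (auto simp: distrib_left add.commute simp flip: power_add)
  then have 1: "(\<Prod>i<s. fps_X ^ s + fps_X ^ i) = fps_X ^ (s choose 2) * euler s"
    by (simp add: prod.distrib prod_fps_X_power e)
  have "(\<Prod>i<s - 1. fps_X ^ s + fps_X ^ (s + 1 + i))
      = (\<Prod>i<s - 1. fps_X ^ s * (1 + fps_X * fps_X ^ i) :: bit fps)"
    by (intro prod.cong) (auto simp: distrib_left power_add)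
  then have 2: "(\<Prod>i<s - 1. fps_X ^ s + fps_X ^ (s + 1 + i)) = fps_X ^ (s * (s - 1)) * euler (s - 1)"
    by (simp add: prod.distrib euler_def qpoch_def power_mult)
  have "s + (s choose 2) + s * (s - 1) = (s choose 2) + s * s"
    using assms by (cases s) auto
  then have 3: "fps_X ^ s * fps_X ^ (s choose 2) * fps_X ^ (s * (s - 1))
      = (fps_X :: bit fps) ^ ((s choose 2) + s * s)"
    by (simp flip: power_add)
  have "s + 1 + (s - 1) = 2 * s" using assms by simp
  then have "parity_half (fps_X :: bit fps) (fps_X ^ s) b (2 * s)
    = fps_X ^ s * (fps_X ^ (s choose 2) * euler s) * (fps_X ^ (s * (s - 1)) * euler (s - 1))"
    using parity_half_balanced[of "fps_X :: bit fps" s b "s - 1"] unfolding 1 2 by (simp only:)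
  also have "\<dots> = (fps_X ^ s * fps_X ^ (s choose 2) * fps_X ^ (s * (s - 1))) * euler s * euler (s - 1)"
    by (simp only: mult_ac)
  finally show ?thesis unfolding 3 .
qed

text \<open>Recentres the binomial sum of order \<open>2 * s\<close> at its middle index. Only odd
  distances from \<open>s\<close> occur, so the middle is skipped and the two arms are
  disjoint.\<close>

lemma odd_shifts:
  fixes s :: nat
  shows "{k. k \<le> 2 * s \<and> odd k = even s}
     = (\<lambda>r. s + r) ` {r. 1 \<le> r \<and> r \<le> s \<and> odd r} \<union> (\<lambda>r. s - r) ` {r. 1 \<le> r \<and> r \<le> s \<and> odd r}"
  (is "?L = ?A \<union> ?B")
proof
  show "?L \<subseteq> ?A \<union> ?B"
  proof
    fix k assume k: "k \<in> ?L"
    then have ne: "k \<noteq> s" by auto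
    show "k \<in> ?A \<union> ?B"
    proof (cases "s \<le> k")
      case True
      with k ne have "k = s + (k - s)" "1 \<le> k - s" "k - s \<le> s" "odd (k - s)" by auto
      then show ?thesis by blast
    next
      case False
      with k have "k = s - (s - k)" "1 \<le> s - k" "s - k \<le> s" "odd (s - k)" by auto
      then show ?thesis by blast
    qed
  qed
qed auto

text \<open>The half whose parity is opposite to \<open>s\<close> is computed twice: in closed form
  by \<open>parity_half_double\<close>, and termwise. The exponents at \<open>s + r\<close> and
  \<open>s - r\<close> differ by \<open>r\<close>, which gives the factor
  \<open>1 + fps_X ^ r\<close>.\<close>

lemma odd_binomial_sum:
  assumes s: "s \<ge> 1"
  shows "(\<Sum>r | 1 \<le> r \<and> r \<le> s \<and> odd r.
      fps_X ^ (r choose 2) * (1 + fps_X ^ r) * reuler (s - r) * reuler (s + r))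
      = euler s * euler (s - 1) * reuler (2 * s)"
proof -
  let ?R = "{r. 1 \<le> r \<and> r \<le> s \<and> odd r}"
  let ?e = "(s choose 2) + s * s"
  define g where "g k = fps_X ^ (k choose 2) * (fps_X ^ s) ^ (2 * s - k) * qbinomial fps_X (2 * s) k
      * reuler (2 * s)" for k
  have plus: "g (s + r) = fps_X ^ ?e * (fps_X ^ (r choose 2) * reuler (s - r) * reuler (s + r))"
    if r: "r \<in> ?R" for r
  proof -
    have d: "2 * s - (s + r) = s - r" by simp
    obtain d where "s = r + d" using r by (auto simp: le_iff_add)
    then have "((s + r) choose 2) + s * (s - r) = ?e + (r choose 2)"
      by (simp add: add_choose_two algebra_simps)
    then have x: "(fps_X :: bit fps) ^ ((s + r) choose 2) * (fps_X ^ s) ^ (s - r)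
       = fps_X ^ ?e * fps_X ^ (r choose 2)"
      by (simp only: flip: power_add power_mult)
    show ?thesis
      using that qbinomial_reuler[of "s + r" "2 * s"] unfolding g_def d x
      by (simp add: mult_ac)
  qed
  have minus: "g (s - r) = fps_X ^ ?e * (fps_X ^ (r choose 2) * fps_X ^ r * reuler (s - r) * reuler (s + r))"
    if r: "r \<in> ?R" for r
  proof -
    have d: "2 * s - (s - r) = s + r" using that by simp
    obtain d where sd: "s = r + d" using r by (auto simp: le_iff_add)
    have "((s - r) choose 2) + s * (s + r) = ?e + (r choose 2) + r"
      using two_choose_two[of r] by (simp add: sd add_choose_two algebra_simps)
    then have x: "(fps_X :: bit fps) ^ ((s - r) choose 2) * (fps_X ^ s) ^ (s + r)
       = fps_X ^ ?e * fps_X ^ (r choose 2) * fps_X ^ r"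
      by (simp only: flip: power_add power_mult)
    show ?thesis
      using that qbinomial_reuler[of "s - r" "2 * s"] unfolding g_def d x
      by (simp add: d mult_ac)
  qed
  have fin: "finite ?R" by simp
  \<comment> \<open>Both sides are compared after multiplication by the common power
    \<open>fps_X ^ ?e\<close>, which is cancelled at the end.\<close>
  have "fps_X ^ ?e * (euler s * euler (s - 1) * reuler (2 * s))
      = parity_half fps_X (fps_X ^ s) (even s) (2 * s) * reuler (2 * s)"
    unfolding parity_half_double[OF s] by (simp only: mult_ac)
  also have "\<dots> = (\<Sum>k | k \<le> 2 * s \<and> odd k = even s. g k)"
    by (simp only: parity_half_def sum_distrib_right g_def)
  also have "\<dots> = (\<Sum>k\<in>(\<lambda>r. s + r) ` ?R. g k) + (\<Sum>k\<in>(\<lambda>r. s - r) ` ?R. g k)"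
    unfolding odd_shifts using fin by (intro sum.union_disjoint) auto
  also have "(\<Sum>k\<in>(\<lambda>r. s + r) ` ?R. g k) = (\<Sum>r\<in>?R. g (s + r))"
    by (subst sum.reindex) (auto simp: inj_on_def)
  also have "(\<Sum>k\<in>(\<lambda>r. s - r) ` ?R. g k) = (\<Sum>r\<in>?R. g (s - r))"
    by (subst sum.reindex) (auto simp: inj_on_def)
  also have "(\<Sum>r\<in>?R. g (s + r)) + (\<Sum>r\<in>?R. g (s - r))
     = fps_X ^ ?e * (\<Sum>r\<in>?R. fps_X ^ (r choose 2) * (1 + fps_X ^ r) * reuler (s - r) * reuler (s + r))"
    unfolding sum.distrib [symmetric] sum_distrib_left
  proof (rule sum.cong [OF refl])
    fix r assume "r \<in> ?R"
    show "g (s + r) + g (s - r) = fps_X ^ ?e *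
      (fps_X ^ (r choose 2) * (1 + fps_X ^ r) * reuler (s - r) * reuler (s + r))"
      unfolding plus[OF \<open>r \<in> ?R\<close>] minus[OF \<open>r \<in> ?R\<close>] by (simp only: algebra_simps mult_1)
  qed
  finally show ?thesis by simp
qed

text \<open>With \<open>s = r + m\<close> this is \<open>q_Chu_Vandermonde\<close> for
  \<open>M = N - r\<close>, \<open>a = q^r\<close>, \<open>b = q^(r+1)\<close>; the signs disappear
  in characteristic 2. The factor \<open>1 + fps_X ^ r\<close> fills the gap between
  \<open>(q)_(r-1)\<close> and the product from \<open>q^(r+1)\<close> to \<open>q^N\<close>,
  completing \<open>(q)_N\<close>.\<close>

lemma conjugate_Bailey_sum:
  assumes r: "1 \<le> r" "r \<le> N"
  shows "(1 + fps_X ^ r) * (\<Sum>s=r..N. fps_X ^ (Suc s choose 2) * euler (s - 1)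
            * reuler (s - r) * reuler (s + r) * reuler (N - s))
      = fps_X ^ (Suc r choose 2) * euler N * reuler (N - r) * reuler (N + r)"
proof -
  let ?X = "fps_X :: bit fps"
  define M where "M = N - r"
  have N: "N = r + M" using r by (simp add: M_def)
  let ?c = "?X ^ (Suc r choose 2) * euler (r - 1) * reuler M * reuler (N + r)"
  have summand: "?X ^ (Suc (r + m) choose 2) * euler (r + m - 1)
            * reuler m * reuler (r + m + r) * reuler (M - m)
     = ?c * ((-1) ^ m * ?X ^ (m choose 2) * qbinomial ?X M m * qpoch (?X ^ r) ?X m * (?X ^ Suc r) ^ m
       * qpoch (?X ^ r * ?X ^ Suc r * ?X ^ m) ?X (M - m))" if m: "m \<le> M" for m
  proof -
    \<comment> \<open>The mixed term \<open>Suc r * m\<close> of the exponent supplies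
      \<open>b ^ m\<close>.\<close>
    have e: "?X ^ (Suc (r + m) choose 2) = ?X ^ (Suc r choose 2) * ?X ^ (m choose 2) * (?X ^ Suc r) ^ m"
      using add_choose_two[of "Suc r" m] by (simp only: power_add power_mult add_Suc)
    have 1: "euler (r + m - 1) = euler (r - 1) * qpoch (?X ^ r) ?X m"
      using r euler_add[of "r - 1" m] by simp
    have x: "?X ^ r * ?X ^ Suc r * ?X ^ m = ?X ^ Suc (r + m + r)"
      by (simp add: power_add mult_ac)
    have "euler (N + r) = euler (r + m + r) * qpoch (?X ^ Suc (r + m + r)) ?X (M - m)"
      using m euler_add[of "r + m + r" "M - m"] by (simp add: N algebra_simps)
    then have 2: "reuler (r + m + r) = qpoch (?X ^ Suc (r + m + r)) ?X (M - m) * reuler (N + r)"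
      by (rule reuler_eqI)
    have 3: "reuler m * reuler (M - m) = qbinomial ?X M m * reuler M"
      using qbinomial_reuler[OF m] by simp
    have "?X ^ (Suc (r + m) choose 2) * euler (r + m - 1)
            * reuler m * reuler (r + m + r) * reuler (M - m)
       = ?X ^ (Suc (r + m) choose 2) * euler (r + m - 1) * (reuler m * reuler (M - m))
            * reuler (r + m + r)" by (simp only: mult_ac)
    then show ?thesis unfolding e 1 2 3 x by (simp add: mult_ac)
  qed
  have "(\<Sum>s=r..N. ?X ^ (Suc s choose 2) * euler (s - 1)
            * reuler (s - r) * reuler (s + r) * reuler (N - s))
      = (\<Sum>m\<le>M. ?X ^ (Suc (r + m) choose 2) * euler (r + m - 1)
            * reuler m * reuler (r + m + r) * reuler (M - m))"
    by (rule sum.reindex_bij_witness[of _ "\<lambda>m. r + m" "\<lambda>s. s - r"]) (auto simp: N add.commute)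
  also have "\<dots> = ?c * qpoch (?X ^ Suc r) ?X M"
    unfolding q_Chu_Vandermonde[of ?X M "?X ^ r" "?X ^ Suc r", symmetric] sum_distrib_left
    by (rule sum.cong [OF refl], rule summand) simp
  finally have *: "(\<Sum>s=r..N. ?X ^ (Suc s choose 2) * euler (s - 1)
            * reuler (s - r) * reuler (s + r) * reuler (N - s)) = ?c * qpoch (?X ^ Suc r) ?X M" .
  have "(1 + ?X ^ r) * euler (r - 1) = euler r"
    using r euler_Suc[of "r - 1"] by (simp add: mult.commute)
  then have "(1 + ?X ^ r) * euler (r - 1) * qpoch (?X ^ Suc r) ?X M = euler N"
    by (simp only: N euler_add)
  moreover have "(1 + ?X ^ r) * (?c * qpoch (?X ^ Suc r) ?X M)
      = ?X ^ (Suc r choose 2) * ((1 + ?X ^ r) * euler (r - 1) * qpoch (?X ^ Suc r) ?X M)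
        * reuler M * reuler (N + r)"
    by (simp only: mult_ac)
  ultimately show ?thesis unfolding * M_def[symmetric] by simp
qed

text \<open>The series \<open>t_s\<close>. It does not involve the cutoff \<open>K\<close>.\<close>

definition spt_summand :: "nat \<Rightarrow> bit fps" where
  "spt_summand s = fps_X ^ (Suc s choose 2) * (euler (s - 1))\<^sup>2 * euler s * reuler (2 * s)"

text \<open>The weights \<open>euler N * reuler (N - s)\<close> make an exact finite identity
  possible: after expanding by \<open>odd_binomial_sum\<close> and exchanging the sums, the sum over
  \<open>s\<close> is that of \<open>conjugate_Bailey_sum\<close>.\<close>

lemma finite_odd_square_identity:
  "(\<Sum>s=1..N. spt_summand s * (euler N * reuler (N - s)))
     = (\<Sum>r | 1 \<le> r \<and> r \<le> N \<and> odd r. fps_X ^ (r * r) * (euler N)\<^sup>2 * reuler (N - r) * reuler (N + r))"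
proof -
  let ?h = "\<lambda>s r. fps_X ^ (r choose 2) * (1 + fps_X ^ r) * euler N * (fps_X ^ (Suc s choose 2)
      * euler (s - 1) * reuler (s - r) * reuler (s + r) * reuler (N - s))"
  have "(\<Sum>s=1..N. spt_summand s * (euler N * reuler (N - s)))
     = (\<Sum>s=1..N. \<Sum>r | 1 \<le> r \<and> r \<le> s \<and> odd r. ?h s r)"
  proof (rule sum.cong [OF refl])
    fix s assume "s \<in> {1..N}"
    then have s: "s \<ge> 1" by simp
    have "spt_summand s * (euler N * reuler (N - s))
       = fps_X ^ (Suc s choose 2) * euler (s - 1) * euler N * reuler (N - s)
          * (euler s * euler (s - 1) * reuler (2 * s))"
      by (simp add: spt_summand_def power2_eq_square mult_ac)
    also have "\<dots> = (\<Sum>r | 1 \<le> r \<and> r \<le> s \<and> odd r. ?h s r)"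
      unfolding odd_binomial_sum[OF s, symmetric] sum_distrib_left
      by (rule sum.cong) (simp_all only: mult_ac)
    finally show "spt_summand s * (euler N * reuler (N - s)) = (\<Sum>r | 1 \<le> r \<and> r \<le> s \<and> odd r. ?h s r)" .
  qed
  also have "\<dots> = (\<Sum>r | 1 \<le> r \<and> r \<le> N \<and> odd r. \<Sum>s=r..N. ?h s r)"
  proof -
    have "(\<Sum>s=1..N. \<Sum>r | 1 \<le> r \<and> r \<le> s \<and> odd r. ?h s r)
       = (\<Sum>s=1..N. \<Sum>r | r \<in> {r. 1 \<le> r \<and> r \<le> N \<and> odd r} \<and> r \<le> s. ?h s r)"
      by (intro sum.cong refl) auto
    also have "\<dots> = (\<Sum>r | 1 \<le> r \<and> r \<le> N \<and> odd r. \<Sum>s | s \<in> {1..N} \<and> r \<le> s. ?h s r)"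
      by (rule sum.swap_restrict) auto
    also have "\<dots> = (\<Sum>r | 1 \<le> r \<and> r \<le> N \<and> odd r. \<Sum>s=r..N. ?h s r)"
      by (intro sum.cong refl) auto
    finally show ?thesis .
  qed
  also have "\<dots> = (\<Sum>r | 1 \<le> r \<and> r \<le> N \<and> odd r.
      fps_X ^ (r * r) * (euler N)\<^sup>2 * reuler (N - r) * reuler (N + r))"
  proof (rule sum.cong [OF refl])
    fix r assume "r \<in> {r. 1 \<le> r \<and> r \<le> N \<and> odd r}"
    then have r: "1 \<le> r" "r \<le> N" by auto
    \<comment> \<open>The squares arise here: one exponent comes from the triple product, the other
      from the q-Chu-Vandermonde sum.\<close>
    have e: "(r choose 2) + (Suc r choose 2) = r * r"
      using two_choose_two[of r] by (simp add: Suc_choose_two)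
    have "(\<Sum>s=r..N. ?h s r) = fps_X ^ (r choose 2) * euler N *
      (fps_X ^ (Suc r choose 2) * euler N * reuler (N - r) * reuler (N + r))"
      unfolding conjugate_Bailey_sum[OF r, symmetric] sum_distrib_left
      by (rule sum.cong) (simp_all only: mult_ac)
    then show "(\<Sum>s=r..N. ?h s r) = fps_X ^ (r * r) * (euler N)\<^sup>2 * reuler (N - r) * reuler (N + r)"
      by (simp add: power2_eq_square mult_ac power_add flip: e)
  qed
  finally show ?thesis .
qed

section \<open>Congruences modulo powers of \<open>fps_X\<close>\<close>

lemma X_power_dvd_imp_nth_eq_0: "fps_X ^ k dvd (f :: bit fps) \<Longrightarrow> n < k \<Longrightarrow> fps_nth f n = 0"
  by (auto simp: fps_X_power_mult_nth)

text \<open>In characteristic 2 the sum is a difference. Every additional factor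
  \<open>1 + fps_X ^ j\<close> has \<open>j > a\<close>, so it is 1 modulo
  \<open>fps_X ^ Suc a\<close>.\<close>

lemma euler_dvd_diff: "fps_X ^ Suc a dvd euler (a + d) + euler a"
proof (induction d)
  case 0
  then show ?case by (simp add: bit_fps_add_self)
next
  case (Suc d)
  have "fps_X ^ Suc (a + d) = (fps_X :: bit fps) ^ Suc a * fps_X ^ d"
    by (simp add: power_add mult_ac)
  then have "fps_X ^ Suc a dvd euler (a + d) * fps_X ^ Suc (a + d)"
    by (metis dvd_mult dvd_triv_left)
  moreover have "euler (a + Suc d) + euler a = (euler (a + d) + euler a) + euler (a + d) * fps_X ^ Suc (a + d)"
    by (simp only: add_Suc_right euler_Suc algebra_simps mult_1 mult_1_right)
  ultimately show ?case using Suc by (metis dvd_add)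
qed

lemma euler_ratio_dvd:
  "fps_X ^ Suc a dvd euler (a + d) * reuler a + 1"
  "fps_X ^ Suc a dvd euler a * reuler (a + d) + 1"
proof -
  have "euler (a + d) * reuler a + 1 = (euler (a + d) + euler a) * reuler a"
    by (simp add: distrib_right)
  then show "fps_X ^ Suc a dvd euler (a + d) * reuler a + 1"
    using euler_dvd_diff by (metis dvd_mult2)
  have "euler a * reuler (a + d) + 1 = (euler (a + d) + euler a) * reuler (a + d)"
    by (simp add: distrib_right add.commute)
  then show "fps_X ^ Suc a dvd euler a * reuler (a + d) + 1"
    using euler_dvd_diff by (metis dvd_mult2)
qed

lemma X_power_dvd_mult:
  assumes "fps_X ^ i dvd f" "fps_X ^ j dvd g" "k \<le> i + j"
  shows "(fps_X :: bit fps) ^ k dvd f * g"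
proof -
  have "(fps_X :: bit fps) ^ (i + j) dvd f * g"
    unfolding power_add using assms(1,2) by (rule mult_dvd_mono)
  then show ?thesis using le_imp_power_dvd[OF assms(3)] by (rule dvd_trans[rotated])
qed

text \<open>Removes the weights from \<open>finite_odd_square_identity\<close>. They are 1 only
  modulo \<open>fps_X ^ Suc (N - s)\<close> or \<open>fps_X ^ Suc (N - r)\<close>, but the terms
  they multiply are divisible by \<open>fps_X ^ (Suc s choose 2)\<close> or
  \<open>fps_X ^ (r * r)\<close>, and these exponents are at least \<open>s\<close> and
  \<open>r\<close>.\<close>

lemma spt_summand_sum_dvd:
  "fps_X ^ Suc N dvd (\<Sum>s=1..N. spt_summand s) + (\<Sum>r | 1 \<le> r \<and> r \<le> N \<and> odd r. fps_X ^ (r * r))"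
proof -
  let ?R = "{r. 1 \<le> r \<and> r \<le> N \<and> odd r}"
  define c where "c s = euler N * reuler (N - s)" for s
  define d where "d r = euler N * reuler (N + r)" for r
  have c: "fps_X ^ Suc (N - s) dvd c s + 1" if "s \<le> N" for s
    using euler_ratio_dvd(1)[of "N - s" s] that by (simp add: c_def)
  have d: "fps_X ^ Suc N dvd d r + 1" for r
    using euler_ratio_dvd(2)[of N r] by (simp add: d_def)
  have "fps_X ^ Suc N dvd spt_summand s + spt_summand s * c s" if "s \<in> {1..N}" for s
  proof -
    have "fps_X ^ (Suc s choose 2) dvd spt_summand s"
      by (simp add: spt_summand_def mult.assoc)
    moreover have "fps_X ^ Suc (N - s) dvd c s + 1" using c that by simp
    moreover have "Suc N \<le> (Suc s choose 2) + Suc (N - s)"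
      using that by (simp add: Suc_choose_two)
    ultimately have "fps_X ^ Suc N dvd spt_summand s * (c s + 1)"
      by (rule X_power_dvd_mult)
    then show ?thesis by (simp add: algebra_simps)
  qed
  then have 1: "fps_X ^ Suc N dvd (\<Sum>s=1..N. spt_summand s) + (\<Sum>s=1..N. spt_summand s * c s)"
    unfolding sum.distrib [symmetric] by (rule dvd_sum)
  have "fps_X ^ Suc N dvd fps_X ^ (r * r) * (c r * d r) + fps_X ^ (r * r)" if "r \<in> ?R" for r
  proof -
    have "fps_X ^ Suc (N - r) dvd (d r + 1) * c r + (c r + 1)"
    proof (rule dvd_add)
      have "fps_X ^ Suc (N - r) dvd (fps_X :: bit fps) ^ Suc N"
        by (rule le_imp_power_dvd) simp
      then show "fps_X ^ Suc (N - r) dvd (d r + 1) * c r"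
        using d by (metis dvd_mult2 dvd_trans)
      show "fps_X ^ Suc (N - r) dvd c r + 1" using c that by simp
    qed
    also have "(d r + 1) * c r + (c r + 1) = c r * d r + 1 + (c r + c r)"
      by (simp add: algebra_simps)
    finally have "fps_X ^ Suc (N - r) dvd c r * d r + 1"
      unfolding bit_fps_add_self by simp
    moreover have "Suc N \<le> r * r + Suc (N - r)"
      using that by (cases r) auto
    ultimately have "fps_X ^ Suc N dvd fps_X ^ (r * r) * (c r * d r + 1)"
      by (intro X_power_dvd_mult[OF dvd_refl])
    then show ?thesis by (simp add: algebra_simps)
  qed
  then have 2: "fps_X ^ Suc N dvd (\<Sum>r\<in>?R. fps_X ^ (r * r) * (c r * d r)) + (\<Sum>r\<in>?R. fps_X ^ (r * r))"
    unfolding sum.distrib [symmetric] by (rule dvd_sum)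
  have 3: "(\<Sum>s=1..N. spt_summand s * c s) = (\<Sum>r\<in>?R. fps_X ^ (r * r) * (c r * d r))"
    unfolding c_def finite_odd_square_identity
    by (rule sum.cong) (simp_all add: d_def power2_eq_square mult_ac)
  \<comment> \<open>The two weighted sums agree by 3; as the repeated middle term \<open>y\<close>
    they cancel.\<close>
  have 4: "x + y + (y + z) = x + z" for x y z :: "bit fps"
    by (metis add.assoc add_0 bit_fps_add_self)
  show ?thesis using dvd_add[OF 1 2] unfolding 3 4 .
qed

text \<open>Up to order \<open>N\<close> only squares of odd numbers occur as exponents, and these
  are odd.\<close>

lemma spt_summand_sum_even_nth:
  assumes "m \<le> N" "even m"
  shows "fps_nth (\<Sum>s=1..N. spt_summand s) m = 0"
proof -
  have "fps_nth (\<Sum>r | 1 \<le> r \<and> r \<le> N \<and> odd r. fps_X ^ (r * r) :: bit fps) m = 0"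
    unfolding fps_sum_nth using assms(2) by (intro sum.neutral) (auto simp: fps_X_power_nth)
  moreover have "fps_nth ((\<Sum>s=1..N. spt_summand s)
      + (\<Sum>r | 1 \<le> r \<and> r \<le> N \<and> odd r. fps_X ^ (r * r))) m = 0"
    by (rule X_power_dvd_imp_nth_eq_0[OF spt_summand_sum_dvd]) (use assms(1) in simp)
  ultimately show ?thesis by (simp only: fps_add_nth add_0_right)
qed

section \<open>Even coefficients under division by \<open>(euler K)\<^sup>2\<close>\<close>

lemma one_plus_X_power_square: "(1 + fps_X ^ j :: bit fps)\<^sup>2 = 1 + fps_X ^ (2 * j)"
proof -
  have "(1 + fps_X ^ j :: bit fps)\<^sup>2 = 1 + fps_X ^ (2 * j) + (fps_X ^ j + fps_X ^ j)"
    by (simp only: power2_eq_square mult_2 mult_2_right power_add algebra_simps mult_1)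
  then show ?thesis unfolding bit_fps_add_self by simp
qed

text \<open>By squaring in characteristic 2, \<open>(euler K)\<^sup>2\<close> is a product of
  factors \<open>1 + fps_X ^ (2 * j)\<close>. They are stripped off one at a time; each links
  coefficients whose indices differ by \<open>2 * j\<close>, hence have equal parity.\<close>

lemma even_nth_eq_0_if_mult_euler_square:
  assumes "\<And>m. m \<le> N \<Longrightarrow> even m \<Longrightarrow> fps_nth (G * (euler K)\<^sup>2) m = 0"
    and "m \<le> N" "even m"
  shows "fps_nth G m = 0"
  using assms
proof (induction K arbitrary: G m)
  case 0
  then show ?case by simp
next
  case (Suc K)
  let ?H = "G * (1 + fps_X ^ (2 * Suc K))"
  have GH: "G * (euler (Suc K))\<^sup>2 = ?H * (euler K)\<^sup>2"
    by (simp only: euler_Suc power_mult_distrib one_plus_X_power_square mult_ac)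
  have H: "fps_nth ?H k = 0" if "k \<le> N" "even k" for k
    by (rule Suc.IH) (use Suc.prems(1) that in \<open>simp_all only: GH\<close>)
  have "k \<le> N \<longrightarrow> even k \<longrightarrow> fps_nth G k = 0" for k
  proof (induction k rule: less_induct)
    case (less k)
    show ?case
    proof (intro impI)
      assume k: "k \<le> N" "even k"
      \<comment> \<open>This is 0 if \<open>k < 2 * Suc K\<close>, and otherwise an earlier even
        coefficient of \<open>G\<close>.\<close>
      have "fps_nth (G * fps_X ^ (2 * Suc K)) k = 0"
        using less[of "k - 2 * Suc K"] k unfolding fps_X_power_mult_right_nth by auto
      moreover have "fps_nth G k + fps_nth (G * fps_X ^ (2 * Suc K)) k = 0"
        using H[OF k] by (simp only: distrib_left mult_1_right fps_add_nth)
      ultimately show "fps_nth G k = 0" by (simp only: add_0_right)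
    qed
  qed
  then show ?case using Suc.prems by blast
qed

subsection \<open>Generating functions of multisets\<close>

definition multisets_with_sum :: "nat set \<Rightarrow> nat \<Rightarrow> nat multiset set" where
  "multisets_with_sum A m = {p. set_mset p \<subseteq> A \<and> sum_mset p = m}"

lemma finite_multisets_with_sum:
  assumes "finite A" "0 \<notin> A"
  shows "finite (multisets_with_sum A m)"
proof -
  let ?L = "{xs. set xs \<subseteq> A \<and> length xs \<le> m}"
  have "multisets_with_sum A m \<subseteq> mset ` ?L"
  proof
    fix p assume p: "p \<in> multisets_with_sum A m"
    obtain xs where xs: "mset xs = p" using ex_mset by blast
    have "is_partition p" using p assms(2)
      by (auto simp: multisets_with_sum_def is_partition_def intro!: gr0I)
    then have "length xs \<le> m"
      using is_partition_size_le[of p] p by (auto simp: multisets_with_sum_def simp flip: xs)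
    then show "p \<in> mset ` ?L" using p xs by (force simp: multisets_with_sum_def)
  qed
  then show ?thesis
    using finite_lists_length_le[OF assms(1)] by (meson finite_imageI finite_subset)
qed

text \<open>Either \<open>a\<close> does not occur or one copy is removed. As \<open>a\<close> stays
  allowed afterwards, a linear recursion results in place of a sum over multiplicities; the test
  \<open>a \<le> m\<close> guards the truncated \<open>m - a\<close>.\<close>

lemma multisets_with_sum_insert:
  "multisets_with_sum (insert a A) m
     = multisets_with_sum A m \<union> add_mset a ` (if a \<le> m then multisets_with_sum (insert a A) (m - a) else {})"
  (is "?L = ?R")
proof
  show "?L \<subseteq> ?R"
  proof
    fix p assume p: "p \<in> ?L"
    show "p \<in> ?R"
    proof (cases "a \<in># p")
      case True
      then obtain p' where "p = add_mset a p'" by (meson multi_member_split)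
      with p show ?thesis by (auto simp: multisets_with_sum_def)
    next
      case False
      with p show ?thesis by (auto simp: multisets_with_sum_def)
    qed
  qed
  show "?R \<subseteq> ?L" by (auto simp: multisets_with_sum_def split: if_splits)
qed

text \<open>The weight \<open>f\<close> is kept general to serve both the number of multisets and
  the number of occurrences of a part.\<close>

lemma sum_multisets_with_sum_insert:
  fixes f :: "nat multiset \<Rightarrow> nat"
  assumes "finite A" "0 \<notin> insert a A" "a \<notin> A"
  shows "(\<Sum>p\<in>multisets_with_sum (insert a A) m. f p) = (\<Sum>p\<in>multisets_with_sum A m. f p)
    + (if a \<le> m then \<Sum>p\<in>multisets_with_sum (insert a A) (m - a). f (add_mset a p) else 0)"
proof -
  let ?S = "if a \<le> m then multisets_with_sum (insert a A) (m - a) else {}"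
  have "(\<Sum>p\<in>multisets_with_sum (insert a A) m. f p)
      = (\<Sum>p\<in>multisets_with_sum A m. f p) + (\<Sum>p\<in>add_mset a ` ?S. f p)"
  proof (subst multisets_with_sum_insert, rule sum.union_disjoint)
    show "finite (multisets_with_sum A m)" "finite (add_mset a ` ?S)"
      using assms by (simp_all add: finite_multisets_with_sum)
    show "multisets_with_sum A m \<inter> add_mset a ` ?S = {}"
    proof -
      have "a \<notin># p" if "p \<in> multisets_with_sum A m" for p
        using that assms(3) by (auto simp: multisets_with_sum_def)
      then show ?thesis by fastforce
    qed
  qed
  also have "(\<Sum>p\<in>add_mset a ` ?S. f p) = (\<Sum>p\<in>?S. f (add_mset a p))"
    by (subst sum.reindex) (auto simp: inj_on_def)
  finally show ?thesis by simp
qed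

definition multiset_fps :: "nat set \<Rightarrow> bit fps" where
  "multiset_fps A = Abs_fps (\<lambda>m. of_nat (card (multisets_with_sum A m)))"

definition count_fps :: "nat \<Rightarrow> nat set \<Rightarrow> bit fps" where
  "count_fps s A = Abs_fps (\<lambda>m. of_nat (\<Sum>p\<in>multisets_with_sum A m. count p s))"

lemma multiset_fps_insert:
  assumes "finite A" "0 \<notin> insert a A" "a \<notin> A"
  shows "multiset_fps (insert a A) * (1 + fps_X ^ a) = multiset_fps A"
proof -
  have "multiset_fps (insert a A) = multiset_fps A + multiset_fps (insert a A) * fps_X ^ a"
    using sum_multisets_with_sum_insert[OF assms, of "\<lambda>_. 1"]
    by (intro fps_ext) (simp add: multiset_fps_def fps_X_power_mult_right_nth del: add_bit_eq_xor)
  then have "multiset_fps (insert a A) - multiset_fps (insert a A) * fps_X ^ a = multiset_fps A"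
    by (simp only: diff_eq_eq)
  then show ?thesis by (simp add: distrib_left)
qed

lemma multiset_fps_prod:
  assumes "finite A" "0 \<notin> A"
  shows "multiset_fps A * (\<Prod>a\<in>A. 1 + fps_X ^ a) = 1"
  using assms
proof (induction A rule: finite_induct)
  case empty
  have "multisets_with_sum {} m = (if m = 0 then {{#}} else {})" for m
    by (auto simp: multisets_with_sum_def)
  then show ?case by (intro fps_ext) (simp add: multiset_fps_def)
next
  case (insert a A)
  have "multiset_fps (insert a A) * (\<Prod>a\<in>insert a A. 1 + fps_X ^ a)
     = (multiset_fps (insert a A) * (1 + fps_X ^ a)) * (\<Prod>a\<in>A. 1 + fps_X ^ a)"
    using insert by (simp add: mult.assoc)
  also have "multiset_fps (insert a A) * (1 + fps_X ^ a) = multiset_fps A"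
    using insert by (intro multiset_fps_insert) auto
  also have "multiset_fps A * (\<Prod>a\<in>A. 1 + fps_X ^ a) = 1"
    using insert by simp
  finally show ?case .
qed

text \<open>Removing one copy of \<open>s\<close> lowers its count by 1, so
  \<open>?W = (?W + ?F) * fps_X ^ s\<close>. One factor \<open>1 + fps_X ^ s\<close> comes from this
  recursion, the other from the product for \<open>?F\<close>.\<close>

lemma count_fps_prod:
  assumes "finite A" "0 \<notin> insert s A" "s \<notin> A"
  shows "count_fps s (insert s A) * (1 + fps_X ^ s)\<^sup>2 * (\<Prod>a\<in>A. 1 + fps_X ^ a) = fps_X ^ s"
proof -
  let ?W = "count_fps s (insert s A)" and ?F = "multiset_fps (insert s A)"
  have 0: "(\<Sum>p\<in>multisets_with_sum A m. count p s) = 0" for m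
    using assms(3) by (intro sum.neutral) (auto simp: multisets_with_sum_def count_eq_zero_iff)
  have "?W = (?W + ?F) * fps_X ^ s"
    using sum_multisets_with_sum_insert[OF assms, of "\<lambda>p. count p s"] unfolding 0
    by (intro fps_ext) (simp add: count_fps_def multiset_fps_def fps_X_power_mult_right_nth
        sum.distrib sum_Suc add.commute del: add_bit_eq_xor)
  then have "?W - ?W * fps_X ^ s = ?F * fps_X ^ s"
    by (simp only: diff_eq_eq distrib_right add.commute)
  then have W: "?W * (1 + fps_X ^ s) = fps_X ^ s * ?F"
    by (simp only: bit_fps_diff distrib_left mult_1_right mult.commute[of ?F])
  have P: "(\<Prod>a\<in>insert s A. 1 + fps_X ^ a) = (1 + fps_X ^ s) * (\<Prod>a\<in>A. 1 + fps_X ^ a :: bit fps)"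
    using assms by simp
  have "?W * (1 + fps_X ^ s)\<^sup>2 * (\<Prod>a\<in>A. 1 + fps_X ^ a)
      = (?W * (1 + fps_X ^ s)) * (\<Prod>a\<in>insert s A. 1 + fps_X ^ a)"
    unfolding P by (simp only: power2_eq_square mult.assoc)
  then have "?W * (1 + fps_X ^ s)\<^sup>2 * (\<Prod>a\<in>A. 1 + fps_X ^ a)
      = fps_X ^ s * (?F * (\<Prod>a\<in>insert s A. 1 + fps_X ^ a))"
    unfolding W by (simp only: mult.assoc)
  also have "\<dots> = fps_X ^ s"
    using multiset_fps_prod[of "insert s A"] assms by simp
  finally show ?thesis .
qed

section \<open>Admissible partitions sorted by smallest part\<close>

text \<open>The parts above \<open>s\<close> that an admissible partition with smallest part \<open>s\<close> may have, the even
  ones cut off at \<open>2 * K\<close>.\<close>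
definition larger_parts :: "nat \<Rightarrow> nat \<Rightarrow> nat set" where
  "larger_parts K s = {s<..2 * s} \<union> (\<lambda>j. 2 * j) ` {s<..K}"

lemma euler_mult_prod: "m \<le> n \<Longrightarrow> euler m * (\<Prod>a\<in>{m<..n}. 1 + fps_X ^ a) = euler n"
proof (induction n rule: dec_induct)
  case base
  then show ?case by simp
next
  case (step n)
  then have "{m<..Suc n} = insert (Suc n) {m<..n}" by auto
  then show ?case using step by (simp add: euler_Suc mult_ac)
qed

text \<open>The parts up to \<open>2 * s\<close> give \<open>Q1\<close>, which is
  \<open>(q)_(2s) / (q)_s\<close>, and the even parts beyond give \<open>Q2\<^sup>2\<close>. Since
  \<open>(q)_K = (q)_(s-1) (1 + q^s) Q2\<close>, the square of \<open>euler K\<close> cancels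
  everything in the denominator but \<open>Q1\<close>. The staircase and one copy of
  \<open>s\<close> account for the exponent \<open>Suc s choose 2\<close>.\<close>

lemma count_fps_larger_parts:
  assumes "1 \<le> s" "s \<le> K"
  shows "fps_X ^ (s choose 2) * count_fps s (insert s (larger_parts K s)) * (euler K)\<^sup>2 = spt_summand s"
proof -
  let ?W = "count_fps s (insert s (larger_parts K s))"
  define Q1 :: "bit fps" where "Q1 = (\<Prod>a\<in>{s<..2 * s}. 1 + fps_X ^ a)"
  define Q2 :: "bit fps" where "Q2 = (\<Prod>a\<in>{s<..K}. 1 + fps_X ^ a)"
  have Q1: "euler s * Q1 = euler (2 * s)" unfolding Q1_def by (rule euler_mult_prod) simp
  have Q2: "euler s * Q2 = euler K" unfolding Q2_def by (rule euler_mult_prod) (rule assms)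
  have s: "euler s = euler (s - 1) * (1 + fps_X ^ s)"
    using assms euler_Suc[of "s - 1"] by simp
  have fin: "finite (larger_parts K s)" "0 \<notin> insert s (larger_parts K s)" "s \<notin> larger_parts K s"
    using assms(1) by (auto simp: larger_parts_def)
  have "(\<Prod>a\<in>larger_parts K s. 1 + fps_X ^ a) = Q1 * (\<Prod>a\<in>(\<lambda>j. 2 * j) ` {s<..K}. 1 + fps_X ^ a)"
    unfolding larger_parts_def Q1_def by (intro prod.union_disjoint) auto
  also have "(\<Prod>a\<in>(\<lambda>j. 2 * j) ` {s<..K}. 1 + fps_X ^ a) = Q2\<^sup>2"
    by (subst prod.reindex)
       (auto simp: inj_on_def Q2_def one_plus_X_power_square prod_power_distrib)
  finally have W: "?W * (1 + fps_X ^ s)\<^sup>2 * (Q1 * Q2\<^sup>2) = fps_X ^ s"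
    using count_fps_prod[of "larger_parts K s" s] fin by simp
  have "fps_X ^ (s choose 2) * ?W * (euler K)\<^sup>2 * euler (2 * s)
      = fps_X ^ (s choose 2) * ?W * (euler (s - 1) * (1 + fps_X ^ s) * Q2)\<^sup>2 * (euler s * Q1)"
    by (simp only: Q1 Q2 flip: s)
  also have "\<dots> = fps_X ^ (s choose 2) * (?W * (1 + fps_X ^ s)\<^sup>2 * (Q1 * Q2\<^sup>2)) * (euler (s - 1))\<^sup>2 * euler s"
    by (simp only: power_mult_distrib mult_ac)
  also have "\<dots> = fps_X ^ (Suc s choose 2) * (euler (s - 1))\<^sup>2 * euler s"
    unfolding W by (simp add: Suc_choose_two power_add)
  finally have "fps_X ^ (s choose 2) * ?W * (euler K)\<^sup>2 * (euler (2 * s) * reuler (2 * s))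
      = fps_X ^ (Suc s choose 2) * (euler (s - 1))\<^sup>2 * euler s * reuler (2 * s)"
    by (simp only: flip: mult.assoc)
  then show ?thesis by (simp add: spt_summand_def)
qed

text \<open>The staircase is determined by \<open>s\<close>, so a pair amounts to its smallest part
  \<open>s\<close> and the partition \<open>p\<close>. All parts are at most \<open>m\<close>, so a
  cutoff \<open>K \<ge> m\<close> loses nothing.\<close>

lemma spt_o_minus_eq_sum:
  assumes "m \<le> K"
  shows "spt_o_minus m = (\<Sum>s=1..K. if s choose 2 \<le> m
     then \<Sum>p\<in>multisets_with_sum (insert s (larger_parts K s)) (m - (s choose 2)). count p s else 0)"
proof -
  let ?M = "\<lambda>s. if s choose 2 \<le> m
     then multisets_with_sum (insert s (larger_parts K s)) (m - (s choose 2)) else {}"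
  let ?T = "\<lambda>s. {p \<in> ?M s. s \<in># p}"
  have finM: "finite (?M s)" if "s \<ge> 1" for s
    using that by (auto simp: larger_parts_def intro!: finite_multisets_with_sum)
  have min: "smallest_part p = s" if "s \<in> {1..K}" "p \<in> ?T s" for s p
    using that unfolding smallest_part_def
    by (intro Min_eqI) (auto simp: multisets_with_sum_def larger_parts_def split: if_splits)
  have adm: "is_partition p" "admissible p" "sum_mset p + (s choose 2) = m"
    if "s \<in> {1..K}" "p \<in> ?T s" for s p
  proof -
    have sub: "set_mset p \<subseteq> insert s (larger_parts K s)"
      using that by (auto simp: multisets_with_sum_def split: if_splits)
    show "is_partition p" using that(1) sub by (auto simp: is_partition_def larger_parts_def)
    show "admissible p" using that(1) sub
      unfolding admissible_def min[OF that] by (fastforce simp: larger_parts_def)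
    show "sum_mset p + (s choose 2) = m"
      using that by (auto simp: multisets_with_sum_def split: if_splits)
  qed
  have conv: "smallest_part p \<in> {1..K}" "p \<in> ?T (smallest_part p)"
    if p: "is_partition p" "p \<noteq> {#}" "admissible p" "sum_mset p + (smallest_part p choose 2) = m" for p
  proof -
    let ?s = "smallest_part p"
    have mem: "?s \<in># p" using p(2) by (simp add: smallest_part_def)
    have le: "k \<le> K" if k: "k \<in># p" for k
    proof -
      obtain p' where "p = add_mset k p'" using k by (meson multi_member_split)
      then show ?thesis using p(4) assms by simp
    qed
    have ge: "?s \<le> k" if "k \<in># p" for k using that by (simp add: smallest_part_def)
    show "?s \<in> {1..K}" using mem le p(1) by (auto simp: is_partition_def Suc_le_eq)
    have "k \<in> insert ?s (larger_parts K ?s)" if k: "k \<in># p" for k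
    proof (cases "k \<le> 2 * ?s")
      case True
      then show ?thesis using ge[OF k] by (auto simp: larger_parts_def)
    next
      case False
      then have "even k" using p(3) k by (auto simp: admissible_def)
      then obtain j where "k = 2 * j" by blast
      then show ?thesis using False le[OF k] by (auto simp: larger_parts_def)
    qed
    then show "p \<in> ?T ?s" using mem p(4) by (auto simp: multisets_with_sum_def)
  qed
  have "spt_o_minus m = (\<Sum>(s, p)\<in>Sigma {1..K} ?T. count p s)"
    unfolding spt_o_minus_def
  proof (rule sum.reindex_bij_witness[of _ "\<lambda>(s, p). (p, staircase s)" "\<lambda>(p, d). (smallest_part p, p)"])
    fix x assume "x \<in> spt_o_minus_pairs m"
    then obtain p where x: "x = (p, staircase (smallest_part p))"
      and p: "is_partition p" "p \<noteq> {#}" "admissible p" "sum_mset p + (smallest_part p choose 2) = m"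
      by (auto simp: spt_o_minus_pairs_def sum_mset_staircase)
    show "(case (case x of (p, d) \<Rightarrow> (smallest_part p, p)) of (s, p) \<Rightarrow> (p, staircase s)) = x"
      using x by simp
    show "(case x of (p, d) \<Rightarrow> (smallest_part p, p)) \<in> Sigma {1..K} ?T"
      using conv[OF p] x by (simp only: prod.case mem_Sigma_iff)
    show "(case (case x of (p, d) \<Rightarrow> (smallest_part p, p)) of (s, p) \<Rightarrow> count p s)
        = (case x of (p, d) \<Rightarrow> count p (smallest_part p))"
      using x by simp
  next
    fix y assume "y \<in> Sigma {1..K} ?T"
    then obtain s p where y: "y = (s, p)" "s \<in> {1..K}" "p \<in> ?T s" by blast
    show "(case (case y of (s, p) \<Rightarrow> (p, staircase s)) of (p, d) \<Rightarrow> (smallest_part p, p)) = y"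
      using y(1) min[OF y(2,3)] by simp
    have "p \<noteq> {#}" using y(3) by auto
    then show "(case y of (s, p) \<Rightarrow> (p, staircase s)) \<in> spt_o_minus_pairs m"
      using y(1) min[OF y(2,3)] adm[OF y(2,3)] by (simp add: spt_o_minus_pairs_def sum_mset_staircase)
  qed
  also have "\<dots> = (\<Sum>s=1..K. \<Sum>p\<in>?T s. count p s)"
    using finM by (subst sum.Sigma) auto
  \<comment> \<open>Multisets without \<open>s\<close> have count 0 and may be added to the
    sum.\<close>
  also have "\<dots> = (\<Sum>s=1..K. \<Sum>p\<in>?M s. count p s)"
    using finM by (intro sum.cong refl sum.mono_neutral_left) (auto simp: not_in_iff)
  also have "\<dots> = (\<Sum>s=1..K. if s choose 2 \<le> m
     then \<Sum>p\<in>multisets_with_sum (insert s (larger_parts K s)) (m - (s choose 2)). count p s else 0)"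
    by (intro sum.cong) auto
  finally show ?thesis .
qed

theorem theorem4:
  fixes n :: nat
  assumes "n \<ge> 1"
  shows "[spt_o_minus (2 * n) = 0] (mod 2)"
proof -
  \<comment> \<open>The cutoff equals the index of the coefficient, as
    \<open>spt_o_minus_eq_sum\<close> permits; vanishing of the even coefficients up to this index
    then suffices.\<close>
  let ?K = "2 * n"
  define G where "G = (\<Sum>s=1..?K. fps_X ^ (s choose 2) * count_fps s (insert s (larger_parts ?K s)))"
  have "of_nat (spt_o_minus ?K) = fps_nth G ?K"
    unfolding spt_o_minus_eq_sum[OF order_refl, of ?K] G_def fps_sum_nth of_nat_sum
    by (intro sum.cong refl) (auto simp: fps_X_power_mult_nth count_fps_def)
  also have "\<dots> = 0"
  proof (rule even_nth_eq_0_if_mult_euler_square)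
    have "G * (euler ?K)\<^sup>2 = (\<Sum>s=1..?K. spt_summand s)"
      unfolding G_def sum_distrib_right by (intro sum.cong refl count_fps_larger_parts) auto
    then show "fps_nth (G * (euler ?K)\<^sup>2) m = 0" if "m \<le> ?K" "even m" for m
      using spt_summand_sum_even_nth that by simp
  qed auto
  finally have "(of_nat (spt_o_minus ?K) :: bit) = 0" .
  then have "even (of_nat (spt_o_minus ?K) :: bit)" by simp
  then have "even (spt_o_minus ?K)" by (simp only: even_of_nat_iff)
  then show ?thesis by (simp add: cong_0_iff)
qed

end
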